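(* Suppose $\{\lambda_n\}_{n\ge 1} \subset \mathbb{D}$ is an interpolating sequence. Let $\{w_n\}_{n\ge 1}$ be a bounded sequence of complex numbers with $\inf_{n \geq 1} |w_n| > 0$. Then there is a bounded outer function $\phi$ on $\mathbb{D}$ such that $\phi(\lambda_n) = w_n$ for all $n\ge 1$.
   Context: $\mathbb{D}$ is the open unit disk in $\mathbb{C}$, $\mathbb{T}$ the unit circle, $m$ normalized Lebesgue measure on $\mathbb{T}$. A sequence $\Lambda=\{\lambda_n\}_{n\ge1}$ of distinct points of $\mathbb{D}$ is interpolating if $\delta(\Lambda) := \inf_{n \geq 1} \prod_{k\ge 1, k \ne n} \left| \frac{\lambda_k-\lambda_n}{1-\overline{\lambda}_k \lambda_n}\right| > 0$; equivalently (Carleson) for every bounded complex sequence $\{w_n\}$ there is a bounded analytic $\phi$ on $\mathbb{D}$ with $\phi(\lambda_n)=w_n$ for all $n$. An outer function is an analytic function on $\mathbb{D}$ of the form $\phi(z)=\gamma\exp\big(\int_{\mathbb{T}} \frac{\xi + z}{\xi - z} W(\xi)\, dm(\xi)\big)$, where $\gamma\in\mathbb{C}$, $|\gamma|=1$, and $W$ is an extended real-valued integrable function on $\mathbb{T}$. A bounded outer function is an outer function that is bounded on $\mathbb{D}$. *)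

theory Defs
  imports "HOL-Analysis.Analysis"
begin

text \<open>
  Sequences are indexed from 0. The infinite product is the limit of its partial products;
  \<open>prodinf\<close> is unsuitable, because it is unspecified for a product that diverges to 0. For points
  of the unit disk the limit exists, see \<open>LIMSEQ_carleson_product\<close> below.
\<close>

definition carleson_product :: "(nat \<Rightarrow> complex) \<Rightarrow> nat \<Rightarrow> real" where
  "carleson_product \<Lambda> n =
     lim (\<lambda>N. \<Prod>k\<in>{..<N} - {n}. cmod ((\<Lambda> k - \<Lambda> n) / (1 - cnj (\<Lambda> k) * \<Lambda> n)))"

definition carleson_delta :: "(nat \<Rightarrow> complex) \<Rightarrow> real" where
  "carleson_delta \<Lambda> = (INF n. carleson_product \<Lambda> n)"

definition interpolating_sequence :: "(nat \<Rightarrow> complex) \<Rightarrow> bool" where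
  "interpolating_sequence \<Lambda> \<longleftrightarrow>
     inj \<Lambda> \<and> range \<Lambda> \<subseteq> ball 0 1 \<and> carleson_delta \<Lambda> > 0"

text \<open>Normalized Lebesgue measure on the Borel sets of the unit circle.\<close>

definition circle_measure :: "complex measure" where
  "circle_measure =
     distr (uniform_measure lborel {0..<2 * pi}) (restrict_space borel (sphere 0 1)) cis"

definition ereal_integrable :: "'a measure \<Rightarrow> ('a \<Rightarrow> ereal) \<Rightarrow> bool" where
  "ereal_integrable M W \<longleftrightarrow>
     W \<in> borel_measurable M \<and> (\<integral>\<^sup>+ x. e2ennreal \<bar>W x\<bar> \<partial>M) < \<infinity>"

text \<open>
  An integrable extended real-valued function is finite almost everywhere, so
  \<open>real_of_ereal\<close>, which sends infinite values to 0, does not affect the integral.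
\<close>

definition outer_function :: "(complex \<Rightarrow> complex) \<Rightarrow> bool" where
  "outer_function \<phi> \<longleftrightarrow>
     \<phi> analytic_on ball 0 1 \<and>
     (\<exists>\<gamma> W. cmod \<gamma> = 1 \<and> ereal_integrable circle_measure W \<and>
       (\<forall>z\<in>ball 0 1. \<phi> z =
          \<gamma> * exp (\<integral>\<xi>. (\<xi> + z) / (\<xi> - z) * complex_of_real (real_of_ereal (W \<xi>)) \<partial>circle_measure)))"

definition bounded_outer_function :: "(complex \<Rightarrow> complex) \<Rightarrow> bool" where
  "bounded_outer_function \<phi> \<longleftrightarrow> outer_function \<phi> \<and> bounded (\<phi> ` ball 0 1)"

lemma pseudo_hyperbolic_le_1:
  assumes "cmod a < 1" "cmod b < 1"
  shows "cmod ((a - b) / (1 - cnj a * b)) \<le> 1"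
proof -
  have "(cmod (1 - cnj a * b))\<^sup>2 - (cmod (a - b))\<^sup>2 = (1 - (cmod a)\<^sup>2) * (1 - (cmod b)\<^sup>2)"
    by (simp only: cmod_power2) (simp add: algebra_simps power2_eq_square)
  moreover have "(1 - (cmod a)\<^sup>2) * (1 - (cmod b)\<^sup>2) \<ge> 0"
    using assms by (intro mult_nonneg_nonneg) (simp_all add: power_le_one)
  ultimately have "(cmod (a - b))\<^sup>2 \<le> (cmod (1 - cnj a * b))\<^sup>2"
    by linarith
  then have "cmod (a - b) \<le> cmod (1 - cnj a * b)"
    by (rule power2_le_imp_le) simp
  then show ?thesis
    by (simp add: norm_divide divide_le_eq_1)
qed

lemma LIMSEQ_carleson_product:
  assumes "range \<Lambda> \<subseteq> ball 0 1"
  shows "(\<lambda>N. \<Prod>k\<in>{..<N} - {n}. cmod ((\<Lambda> k - \<Lambda> n) / (1 - cnj (\<Lambda> k) * \<Lambda> n)))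
           \<longlonglongrightarrow> carleson_product \<Lambda> n"
proof -
  define g where "g = (\<lambda>k. cmod ((\<Lambda> k - \<Lambda> n) / (1 - cnj (\<Lambda> k) * \<Lambda> n)))"
  define P where "P = (\<lambda>N. \<Prod>k\<in>{..<N} - {n}. g k)"
  have "cmod (\<Lambda> k) < 1" for k
    using assms by (auto simp: image_subset_iff)
  then have g: "0 \<le> g k" "g k \<le> 1" for k
    using pseudo_hyperbolic_le_1[of "\<Lambda> k" "\<Lambda> n"] by (simp_all add: g_def)
  have P0: "0 \<le> P N" for N
    unfolding P_def by (intro prod_nonneg ballI g)
  have "P (Suc N) \<le> P N" for N
  proof (cases "N = n")
    case False
    then have "P (Suc N) = g N * P N"
      by (simp add: P_def lessThan_Suc insert_Diff_if)
    then show ?thesis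
      using mult_left_le_one_le[OF P0[of N] g] by simp
  qed (simp add: P_def lessThan_Suc)
  then have "decseq P"
    by (rule decseq_SucI)
  then have "convergent P"
    using decseq_convergent[of P 0] P0 by (meson convergentI)
  then show ?thesis
    by (simp add: convergent_LIMSEQ_iff P_def g_def carleson_product_def)
qed

lemma measurable_cis_circle:
  "cis \<in> uniform_measure lborel {0..<2 * pi} \<rightarrow>\<^sub>M restrict_space borel (sphere 0 1)"
proof (rule measurable_restrict_space2)
  have "cis \<in> borel_measurable borel"
    by (intro borel_measurable_continuous_onI continuous_intros)
  then show "cis \<in> borel_measurable (uniform_measure lborel {0..<2 * pi})"
    by (simp cong: measurable_cong_sets)
qed auto

lemma space_circle_measure: "space circle_measure = sphere 0 1"
  by (simp add: circle_measure_def space_restrict_space)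

lemma emeasure_circle_measure_space: "emeasure circle_measure (sphere 0 1) = 1"
proof -
  have "sphere (0::complex) 1 \<in> sets (restrict_space borel (sphere 0 1))"
    by (simp add: sets_restrict_space_iff)
  then have "emeasure circle_measure (sphere 0 1) =
      emeasure (uniform_measure lborel {0..<2 * pi}) UNIV"
    by (simp add: circle_measure_def emeasure_distr measurable_cis_circle vimage_def)
  also have "\<dots> = 1"
    by (simp add: emeasure_uniform_measure divide_ennreal flip: ennreal_1)
  finally show ?thesis .
qed

end

theory Submission
  imports Defs "HOL-Complex_Analysis.Complex_Analysis"
begin

text \<open>
  The numbers \<open>Ln (w n)\<close> are bounded, so Carleson's theorem yields a bounded analytic \<open>g\<close> with
  \<open>g (\<Lambda> n) = Ln (w n)\<close>, and \<open>\<phi> = exp g\<close> is the required function. Carleson's theorem is obtained from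
  P. Jones's explicit interpolation formula for finitely many points, whose bound depends only on
  \<open>carleson_delta \<Lambda>\<close>, and Montel's theorem. That \<open>exp g\<close> is outer needs boundary values of \<open>g\<close>:
  by Parseval the dilates \<open>g (r \<xi>)\<close> are Cauchy in \<open>L\<^sup>2\<close> of the circle as \<open>r\<close> tends to 1, so they converge
  almost everywhere along some sequence of radii, and dominated convergence carries the Schwarz
  integral formula over from the dilates to \<open>g\<close>.
\<close>

section \<open>Carleson's interpolation theorem\<close>

text \<open>A Riemann-sum form of \<open>\<integral>\<^sub>0\<^sup>\<infinity> exp (- t) dt = 1\<close>; ties in \<open>r\<close> only decrease the sum.\<close>

lemma sum_exp_tail_le_1:
  fixes a r :: "'a \<Rightarrow> real"
  assumes "finite S" and "\<And>x. x \<in> S \<Longrightarrow> 0 \<le> a x"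
  shows "(\<Sum>j\<in>S. a j * exp (- (\<Sum>m\<in>{m\<in>S. r j \<le> r m}. a m))) \<le> 1"
  using assms
proof (induction rule: finite_ranking_induct[where f = r])
  case (insert x S)
  show ?case
  proof (cases "x \<in> S")
    case True
    then show ?thesis
      using insert by (simp add: insert_absorb)
  next
    case False
    define T where "T j = (\<Sum>m\<in>{m\<in>S. r j \<le> r m}. a m)" for j
    \<comment> \<open>\<open>finite_ranking_induct\<close> adds a point \<open>x\<close> of maximal
      rank, so \<open>a x\<close> occurs in every tail. The old sum is thus scaled by
      \<open>exp (- a x)\<close>, the new term is at most \<open>a x * exp (- a x)\<close>, and
      \<open>1 + a x \<le> exp (a x)\<close> closes the induction.\<close>
    have T: "(\<Sum>m\<in>{m\<in>insert x S. r j \<le> r m}. a m) = a x + T j" if "j \<in> insert x S" for j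
    proof -
      have "{m\<in>insert x S. r j \<le> r m} = insert x {m\<in>S. r j \<le> r m}"
        using that insert.hyps by auto
      then show ?thesis
        using False insert.hyps by (simp add: T_def)
    qed
    have ax: "0 \<le> a x"
      using insert.prems by simp
    have "0 \<le> T x"
      unfolding T_def using insert.prems by (intro sum_nonneg) auto
    then have "a x * exp (- (a x + T x)) \<le> a x * exp (- a x)"
      using ax by (intro mult_left_mono) auto
    moreover have "(\<Sum>j\<in>S. a j * exp (- (a x + T j))) = exp (- a x) * (\<Sum>j\<in>S. a j * exp (- T j))"
      by (simp add: sum_distrib_left exp_add exp_diff exp_minus field_simps)
    moreover have "exp (- a x) * (\<Sum>j\<in>S. a j * exp (- T j)) \<le> exp (- a x) * 1"
      using insert.IH insert.prems unfolding T_def by (intro mult_left_mono) auto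
    ultimately have "a x * exp (- (a x + T x)) + (\<Sum>j\<in>S. a j * exp (- (a x + T j))) \<le> (1 + a x) * exp (- a x)"
      unfolding distrib_right by linarith
    also have "\<dots> \<le> exp (a x) * exp (- a x)"
      by (intro mult_right_mono exp_ge_add_one_self) auto
    also have "\<dots> = 1"
      by (simp flip: exp_add)
    finally have "(\<Sum>j\<in>insert x S. a j * exp (- (a x + T j))) \<le> 1"
      using False insert.hyps by simp
    then show ?thesis
      using T by (simp only: cong: sum.cong)
  qed
qed simp

section \<open>Blaschke factors and bounded interpolation at finitely many points\<close>

definition blaschke_factor :: "complex \<Rightarrow> complex \<Rightarrow> complex" where
  "blaschke_factor a z = (a - z) / (1 - cnj a * z)"

lemma one_minus_cnj_mult_nonzero:
  assumes "cmod a < 1" "cmod z \<le> 1"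
  shows "1 - cnj a * z \<noteq> 0"
proof
  assume "1 - cnj a * z = 0"
  then have "cmod (cnj a * z) = 1"
    by simp
  moreover have "cmod a * cmod z \<le> cmod a"
    using assms by (simp add: mult_left_le)
  ultimately show False
    using assms by (simp add: norm_mult)
qed

text \<open>This identity ties the kernels in Jones's formula, which have the right-hand side's
  shape, to the pseudo-hyperbolic distances in Carleson's condition.\<close>

lemma one_minus_blaschke_factor:
  assumes "cmod a < 1" "cmod z < 1"
  shows "1 - (cmod (blaschke_factor a z))\<^sup>2 =
    (1 - (cmod a)\<^sup>2) * (1 - (cmod z)\<^sup>2) / (cmod (1 - cnj a * z))\<^sup>2"
proof -
  have "(cmod (1 - cnj a * z))\<^sup>2 - (cmod (a - z))\<^sup>2 = (1 - (cmod a)\<^sup>2) * (1 - (cmod z)\<^sup>2)"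
    by (simp only: cmod_power2) (simp add: algebra_simps power2_eq_square)
  moreover have "cmod (1 - cnj a * z) \<noteq> 0"
    using one_minus_cnj_mult_nonzero assms by simp
  ultimately show ?thesis
    by (simp add: blaschke_factor_def norm_divide power_divide field_simps)
qed

lemma Re_Cayley: "Re ((1 + u) / (1 - u)) = (1 - (cmod u)\<^sup>2) / (cmod (1 - u))\<^sup>2"
  by (simp only: Re_divide cmod_power2) (simp add: algebra_simps power2_eq_square)

text \<open>The bound involves only \<open>C\<close> and \<delta>, not the number of points, so it
  survives the passage to an infinite sequence. One factor \<open>1 / \<delta>\<close> comes from
  normalizing the Blaschke products and \<open>exp 2 / \<delta> ^ 4\<close> from normalizing the
  exponentials.\<close>

lemma finite_interpolation:
  fixes l v :: "'i \<Rightarrow> complex"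
  assumes S: "finite S" and l: "\<And>k. k \<in> S \<Longrightarrow> cmod (l k) < 1"
    and "0 < \<delta>" and \<delta>: "\<And>j. j \<in> S \<Longrightarrow> \<delta> \<le> (\<Prod>k\<in>S-{j}. cmod (blaschke_factor (l k) (l j)))"
    and v: "\<And>j. j \<in> S \<Longrightarrow> cmod (v j) \<le> C" and "0 \<le> C"
  shows "\<exists>f. f holomorphic_on ball 0 1 \<and> (\<forall>z\<in>ball 0 1. cmod (f z) \<le> C * exp 2 / \<delta> ^ 5) \<and>
    (\<forall>j\<in>S. f (l j) = v j)"
proof -
  define B where "B j z = (\<Prod>k\<in>S-{j}. blaschke_factor (l k) z)" for j z
  \<comment> \<open>By \<open>Re_Cayley\<close> with \<open>u = cnj (l m) * z\<close>, the real part
    of \<open>p m z\<close> is nonnegative in the disk, so \<open>exp (- p m z)\<close> acts as a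
    damping factor.\<close>
  define p where "p m z = of_real (1 - (cmod (l m))\<^sup>2) * ((1 + cnj (l m) * z) / (1 - cnj (l m) * z))" for m z
  \<comment> \<open>Only points at least as far out as \<open>l j\<close> enter. For these,
    \<open>1 - x * y \<le> 2 * (1 - y)\<close> with \<open>x\<close>, \<open>y\<close> the squared
    moduli of \<open>l m\<close>, \<open>l j\<close>, which lets 1 - \<rho>^2 control the exponent
    at \<open>l j\<close> in \<open>p_l\<close>.\<close>
  define T where "T j = {m\<in>S. cmod (l j) \<le> cmod (l m)}" for j
  \<comment> \<open>P. Jones's formula. By \<open>F_le\<close> below, \<open>\<Sum>j\<in>S. cmod (F j z)\<close> is controlled by \<open>sum_exp_tail_le_1\<close>
    applied to \<open>a m = Re (p m z)\<close>, with the points ordered by modulus.\<close>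
  define F where "F j z = B j z / B j (l j) * (of_real (1 - (cmod (l j))\<^sup>2) / (1 - cnj (l j) * z))\<^sup>2 *
     exp ((\<Sum>m\<in>T j. p m (l j)) - (\<Sum>m\<in>T j. p m z))" for j z
  define f where "f z = (\<Sum>j\<in>S. v j * F j z)" for z
  have nz: "1 - cnj (l j) * z \<noteq> 0" if "j \<in> S" "cmod z < 1" for j z
    using one_minus_cnj_mult_nonzero[of "l j" z] l that by simp
  have sq: "(cmod (l j))\<^sup>2 < 1" if "j \<in> S" for j
    using l[OF that] by (simp add: power_less_one_iff)
  have Re_mult: "Re (of_real c * w) = c * Re w" for c w
    by simp
  have Re_p: "Re (p m z) = (1 - (cmod (l m))\<^sup>2) * (1 - (cmod (l m))\<^sup>2 * (cmod z)\<^sup>2) / (cmod (1 - cnj (l m) * z))\<^sup>2" for m z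
    unfolding p_def Re_mult Re_Cayley by (simp add: norm_mult power_mult_distrib)
  have B: "\<delta> \<le> cmod (B j (l j))" if "j \<in> S" for j
    using \<delta>[OF that] by (simp add: B_def prod_norm)
  have B_le: "cmod (B j z) \<le> 1" if "cmod z < 1" for j z
    unfolding B_def prod_norm[symmetric]
    using that l by (intro prod_le_1) (auto simp: blaschke_factor_def intro: pseudo_hyperbolic_le_1)

  have p_l: "exp (\<Sum>m\<in>T j. Re (p m (l j))) \<le> exp 2 / \<delta> ^ 4" if j: "j \<in> S" for j
  proof -
    define \<rho> where "\<rho> m = cmod (blaschke_factor (l m) (l j))" for m
    have \<rho>1: "0 \<le> 1 - (\<rho> m)\<^sup>2" if "m \<in> S" for m
      using pseudo_hyperbolic_le_1[OF l[OF that] l[OF j]]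
      by (simp add: \<rho>_def blaschke_factor_def power_le_one)
    have "(\<Sum>m\<in>T j. Re (p m (l j))) \<le> (\<Sum>m\<in>T j. 2 * (1 - (\<rho> m)\<^sup>2))"
    proof (rule sum_mono)
      fix m assume "m \<in> T j"
      then have m: "m \<in> S" "cmod (l j) \<le> cmod (l m)"
        by (auto simp: T_def)
      define x y where "x = (cmod (l m))\<^sup>2" and "y = (cmod (l j))\<^sup>2"
      have xy: "y \<le> x" "x < 1" "y < 1" "0 \<le> y"
        using m j sq by (auto simp: x_def y_def intro: power_mono)
      have "0 \<le> (1 - x) * (1 - y)"
        using xy by simp
      then have "1 - x * y \<le> 2 * (1 - y)"
        using xy by (simp add: algebra_simps)
      then have "(1 - x) * (1 - x * y) / (cmod (1 - cnj (l m) * l j))\<^sup>2 \<le>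
          (1 - x) * (2 * (1 - y)) / (cmod (1 - cnj (l m) * l j))\<^sup>2"
        using xy by (intro divide_right_mono mult_left_mono) auto
      also have "\<dots> = 2 * (1 - (\<rho> m)\<^sup>2)"
        unfolding \<rho>_def one_minus_blaschke_factor[OF l[OF m(1)] l[OF j]] x_def y_def by simp
      finally show "Re (p m (l j)) \<le> 2 * (1 - (\<rho> m)\<^sup>2)"
        unfolding Re_p x_def y_def .
    qed
    also have "\<dots> \<le> (\<Sum>m\<in>S. 2 * (1 - (\<rho> m)\<^sup>2))"
      using S \<rho>1 by (intro sum_mono2) (auto simp: T_def)
    \<comment> \<open>The term \<open>m = j\<close> has \<rho> = 0 and contributes 2; this is the
      source of \<open>exp 2\<close>.\<close>
    also have "\<dots> = 2 + (\<Sum>m\<in>S-{j}. 2 * (1 - (\<rho> m)\<^sup>2))"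
      using S j by (subst sum.remove[of _ j]) (auto simp: \<rho>_def blaschke_factor_def)
    finally have "exp (\<Sum>m\<in>T j. Re (p m (l j))) \<le> exp 2 * exp (\<Sum>m\<in>S-{j}. 2 * (1 - (\<rho> m)\<^sup>2))"
      by (simp flip: exp_add)
    \<comment> \<open>Factor by factor: \<open>t \<le> exp (t - 1)\<close> at t = \<rho>^2, squared
      to match the 2 in the exponent, gives \<rho>^4 \<le> exp (-2 (1 - \<rho>^2)). The product of
      the \<rho> is at least \<delta>, hence the fourth power.\<close>
    moreover have "\<delta> ^ 4 * exp (\<Sum>m\<in>S-{j}. 2 * (1 - (\<rho> m)\<^sup>2)) \<le> 1"
    proof -
      have "\<delta> ^ 4 \<le> (\<Prod>m\<in>S-{j}. \<rho> m) ^ 4"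
        using \<delta>[OF j] \<open>0 < \<delta>\<close> unfolding \<rho>_def by (intro power_mono) auto
      then have "\<delta> ^ 4 * exp (\<Sum>m\<in>S-{j}. 2 * (1 - (\<rho> m)\<^sup>2)) \<le>
          (\<Prod>m\<in>S-{j}. \<rho> m) ^ 4 * exp (\<Sum>m\<in>S-{j}. 2 * (1 - (\<rho> m)\<^sup>2))"
        by (intro mult_right_mono) auto
      also have "\<dots> = (\<Prod>m\<in>S-{j}. \<rho> m ^ 4 * exp (2 * (1 - (\<rho> m)\<^sup>2)))"
        using S by (simp add: exp_sum prod.distrib prod_power_distrib)
      also have "\<dots> \<le> 1"
      proof (rule prod_le_1)
        fix m
        have "(\<rho> m)\<^sup>2 \<le> exp ((\<rho> m)\<^sup>2 - 1)"
          using exp_ge_add_one_self[of "(\<rho> m)\<^sup>2 - 1"] by simp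
        then have "((\<rho> m)\<^sup>2)\<^sup>2 \<le> (exp ((\<rho> m)\<^sup>2 - 1))\<^sup>2"
          by (intro power_mono) auto
        also have "\<dots> = exp (- (2 * (1 - (\<rho> m)\<^sup>2)))"
          by (simp add: algebra_simps flip: exp_double)
        finally have "\<rho> m ^ 4 * exp (2 * (1 - (\<rho> m)\<^sup>2)) \<le>
            exp (- (2 * (1 - (\<rho> m)\<^sup>2))) * exp (2 * (1 - (\<rho> m)\<^sup>2))"
          by (intro mult_right_mono) auto
        then show "0 \<le> \<rho> m ^ 4 * exp (2 * (1 - (\<rho> m)\<^sup>2)) \<and> \<rho> m ^ 4 * exp (2 * (1 - (\<rho> m)\<^sup>2)) \<le> 1"
          by (simp add: \<rho>_def flip: exp_add)
      qed
      finally show ?thesis .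
    qed
    then have "exp 2 * exp (\<Sum>m\<in>S-{j}. 2 * (1 - (\<rho> m)\<^sup>2)) \<le> exp 2 / \<delta> ^ 4"
      using \<open>0 < \<delta>\<close> by (simp add: field_simps)
    ultimately show ?thesis
      by (rule order_trans)
  qed

  \<comment> \<open>The factors of \<open>F\<close> are estimated separately: the Blaschke quotient
    by \<open>1 / \<delta>\<close>, the squared kernel by \<open>Re (p j z)\<close> because the
    modulus of \<open>z\<close> is below 1, and the constant part of the exponential by
    \<open>p_l\<close>.\<close>
  have F_le: "cmod (F j z) \<le> exp 2 / \<delta> ^ 5 * (Re (p j z) * exp (- (\<Sum>m\<in>T j. Re (p m z))))"
    if j: "j \<in> S" and z: "cmod z < 1" for j z
  proof -
    have "cmod (B j z / B j (l j)) \<le> 1 / \<delta>"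
      unfolding norm_divide using B[OF j] B_le[OF z] \<open>0 < \<delta>\<close> by (intro frac_le) auto
    moreover have "cmod ((of_real (1 - (cmod (l j))\<^sup>2) / (1 - cnj (l j) * z))\<^sup>2) \<le> Re (p j z)"
    proof -
      have "(cmod (l j))\<^sup>2 * (cmod z)\<^sup>2 \<le> (cmod (l j))\<^sup>2"
        using z by (simp add: mult_left_le power_le_one)
      then have "(1 - (cmod (l j))\<^sup>2)\<^sup>2 \<le> (1 - (cmod (l j))\<^sup>2) * (1 - (cmod (l j))\<^sup>2 * (cmod z)\<^sup>2)"
        unfolding power2_eq_square[of "1 - _"] using sq[OF j] by (intro mult_left_mono) auto
      then show ?thesis
        unfolding Re_p norm_power norm_divide norm_of_real power_divide power2_abs
        by (intro divide_right_mono) auto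
    qed
    moreover have "cmod (exp ((\<Sum>m\<in>T j. p m (l j)) - (\<Sum>m\<in>T j. p m z))) =
        exp (\<Sum>m\<in>T j. Re (p m (l j))) * exp (- (\<Sum>m\<in>T j. Re (p m z)))"
      by (simp add: norm_exp_eq_Re flip: exp_add)
    then have "cmod (exp ((\<Sum>m\<in>T j. p m (l j)) - (\<Sum>m\<in>T j. p m z))) \<le>
        exp 2 / \<delta> ^ 4 * exp (- (\<Sum>m\<in>T j. Re (p m z)))"
      by (simp only: mult_right_mono[OF p_l[OF j]] exp_ge_zero)
    ultimately have "cmod (F j z) \<le> 1 / \<delta> * Re (p j z) * (exp 2 / \<delta> ^ 4 * exp (- (\<Sum>m\<in>T j. Re (p m z))))"
      unfolding F_def norm_mult using \<open>0 < \<delta>\<close>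
      by (intro mult_mono mult_nonneg_nonneg) (auto intro: order_trans[OF norm_ge_zero])
    also have "\<dots> = exp 2 / \<delta> ^ 5 * (Re (p j z) * exp (- (\<Sum>m\<in>T j. Re (p m z))))"
      by (simp add: numeral_eq_Suc)
    finally show ?thesis .
  qed

  have "f holomorphic_on ball 0 1"
    unfolding f_def F_def B_def p_def blaschke_factor_def
    using S nz by (intro holomorphic_intros) (auto simp: T_def)
  moreover have "cmod (f z) \<le> C * exp 2 / \<delta> ^ 5" if "z \<in> ball 0 1" for z
  proof -
    have z: "cmod z < 1"
      using that by simp
    have p0: "0 \<le> Re (p m z)" if "m \<in> S" for m
      unfolding Re_p using sq[OF that] z
      by (intro divide_nonneg_nonneg mult_nonneg_nonneg) (auto simp: mult_le_one power_le_one)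
    have "cmod (f z) \<le> (\<Sum>j\<in>S. C * (exp 2 / \<delta> ^ 5 * (Re (p j z) * exp (- (\<Sum>m\<in>T j. Re (p m z))))))"
      unfolding f_def
    proof (rule sum_norm_le)
      fix j assume "j \<in> S"
      then show "cmod (v j * F j z) \<le> C * (exp 2 / \<delta> ^ 5 * (Re (p j z) * exp (- (\<Sum>m\<in>T j. Re (p m z)))))"
        unfolding norm_mult using \<open>0 \<le> C\<close> z by (intro mult_mono v F_le) auto
    qed
    also have "\<dots> = C * exp 2 / \<delta> ^ 5 * (\<Sum>j\<in>S. Re (p j z) * exp (- (\<Sum>m\<in>T j. Re (p m z))))"
      by (simp add: sum_distrib_left mult.assoc)
    also have "\<dots> \<le> C * exp 2 / \<delta> ^ 5 * 1"
      unfolding T_def using S p0 \<open>0 \<le> C\<close> \<open>0 < \<delta>\<close>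
      by (intro mult_left_mono sum_exp_tail_le_1) auto
    finally show ?thesis
      by simp
  qed
  moreover have "f (l k) = v k" if k: "k \<in> S" for k
  proof -
    \<comment> \<open>\<open>B j\<close> vanishes at the other points. At \<open>l j\<close> itself
      the Blaschke quotient and the kernel are 1 and the two sums in the exponent cancel.\<close>
    have "F j (l k) = (if j = k then 1 else 0)" if j: "j \<in> S" for j
    proof (cases "j = k")
      case True
      have "B k (l k) \<noteq> 0"
        using B[OF k] \<open>0 < \<delta>\<close> by auto
      moreover have "of_real (1 - (cmod (l k))\<^sup>2) = 1 - cnj (l k) * l k"
        by (simp add: complex_norm_square mult.commute del: of_real_power)
      ultimately show ?thesis
        using True nz[OF k l[OF k]] by (simp add: F_def)
    next
      case False
      then have "B j (l k) = 0"
        unfolding B_def using S k by (intro prod_zero) (auto simp: blaschke_factor_def)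
      then show ?thesis
        using False by (simp add: F_def)
    qed
    then have "f (l k) = (\<Sum>j\<in>S. v j * (if j = k then 1 else 0))"
      unfolding f_def by (intro sum.cong) auto
    then show ?thesis
      using S k by (simp add: if_distrib[of "\<lambda>x. _ * x"] cong: if_cong)
  qed
  ultimately show ?thesis
    by blast
qed

text \<open>All factors are at most 1, so partial products decrease to
  \<open>carleson_product\<close> and stay above it. This supplies the separation hypothesis of
  \<open>finite_interpolation\<close> for each initial segment of the sequence.\<close>

lemma carleson_delta_le_finite_product:
  assumes "range \<Lambda> \<subseteq> ball 0 1"
  shows "carleson_delta \<Lambda> \<le> (\<Prod>k\<in>{..<N} - {n}. cmod (blaschke_factor (\<Lambda> k) (\<Lambda> n)))"
proof -
  define P where "P n N = (\<Prod>k\<in>{..<N} - {n}. cmod (blaschke_factor (\<Lambda> k) (\<Lambda> n)))" for n N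
  have lim: "P n \<longlonglongrightarrow> carleson_product \<Lambda> n" for n
    using LIMSEQ_carleson_product[OF assms] unfolding P_def blaschke_factor_def .
  have P0: "0 \<le> P n N" for n N
    unfolding P_def by (intro prod_nonneg) auto
  have "cmod (\<Lambda> k) < 1" for k
    using assms by (auto simp: image_subset_iff)
  then have le_1: "cmod (blaschke_factor (\<Lambda> k) (\<Lambda> n)) \<le> 1" for k n
    by (simp only: blaschke_factor_def pseudo_hyperbolic_le_1)
  have "P n M \<le> P n N" if "N \<le> M" for M
  proof -
    have "P n M = (\<Prod>k\<in>({..<M} - {n}) - ({..<N} - {n}). cmod (blaschke_factor (\<Lambda> k) (\<Lambda> n))) * P n N"
      unfolding P_def using that by (intro prod.subset_diff) auto
    also have "\<dots> \<le> P n N"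
      by (intro mult_left_le_one_le P0 prod_le_1 prod_nonneg) (auto simp: le_1)
    finally show ?thesis .
  qed
  then have "carleson_product \<Lambda> n \<le> P n N"
    by (intro LIMSEQ_le_const2[OF lim]) auto
  moreover have "bdd_below (range (carleson_product \<Lambda>))"
    using LIMSEQ_le_const[OF lim] P0 by (intro bdd_belowI2[of _ 0]) blast
  then have "carleson_delta \<Lambda> \<le> carleson_product \<Lambda> n"
    unfolding carleson_delta_def by (rule cINF_lower) auto
  ultimately show ?thesis
    by (simp add: P_def)
qed

text \<open>The problems for the first \<open>N\<close> points have solutions with a common bound
  \<open>K\<close>, so Montel's theorem gives a locally uniform limit of a subsequence. A fixed node
  is matched by all but finitely many terms, since \<open>r i \<ge> i\<close>.\<close>

lemma Carleson_interpolation: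
  assumes "interpolating_sequence \<Lambda>" and "bounded (range v)"
  obtains g K where "g holomorphic_on ball 0 1" "\<And>z. z \<in> ball 0 1 \<Longrightarrow> cmod (g z) \<le> K"
    "\<And>n. g (\<Lambda> n) = v n"
proof -
  have \<Lambda>: "range \<Lambda> \<subseteq> ball 0 1" and \<delta>: "0 < carleson_delta \<Lambda>"
    using assms by (auto simp: interpolating_sequence_def)
  obtain C where C: "0 < C" "\<And>n. cmod (v n) \<le> C"
    using assms(2) by (auto simp: bounded_pos)
  define K where "K = C * exp 2 / carleson_delta \<Lambda> ^ 5"
  have "\<exists>f. f holomorphic_on ball 0 1 \<and> (\<forall>z\<in>ball 0 1. cmod (f z) \<le> K) \<and> (\<forall>n\<in>{..<N}. f (\<Lambda> n) = v n)" for N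
    unfolding K_def
    using \<Lambda> C \<delta> by (intro finite_interpolation carleson_delta_le_finite_product) (auto simp: image_subset_iff less_imp_le)
  then obtain f where f: "\<And>N. f N holomorphic_on ball 0 1" "\<And>N z. z \<in> ball 0 1 \<Longrightarrow> cmod (f N z) \<le> K"
    "\<And>N n. n < N \<Longrightarrow> f N (\<Lambda> n) = v n"
    by (metis lessThan_iff)
  define H where "H = {h. h holomorphic_on ball 0 1 \<and> (\<forall>z\<in>ball 0 1. cmod (h z) \<le> K)}"
  obtain g r where g: "g holomorphic_on ball 0 1" and r: "strict_mono (r :: nat \<Rightarrow> nat)"
    and lim: "\<And>z. z \<in> ball 0 1 \<Longrightarrow> (\<lambda>i. f (r i) z) \<longlonglongrightarrow> g z"
  proof (rule Montel[of "ball 0 1" H f])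
    show "\<exists>B. \<forall>h\<in>H. \<forall>z\<in>X. cmod (h z) \<le> B" if "X \<subseteq> ball 0 1" for X
      using that by (auto simp: H_def intro!: exI[of _ K])
    show "range f \<subseteq> H"
      using f by (auto simp: H_def)
  qed (auto simp: H_def)
  show ?thesis
  proof
    show "g holomorphic_on ball 0 1"
      by (rule g)
    show "cmod (g z) \<le> K" if "z \<in> ball 0 1" for z
      using f(2)[OF that] by (intro Lim_norm_ubound[OF _ lim[OF that]]) auto
    show "g (\<Lambda> n) = v n" for n
    proof (rule LIMSEQ_unique)
      show "(\<lambda>i. f (r i) (\<Lambda> n)) \<longlonglongrightarrow> g (\<Lambda> n)"
        using \<Lambda> by (intro lim) (auto simp: image_subset_iff)
      have "f (r i) (\<Lambda> n) = v n" if "i > n" for i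
        using that seq_suble[OF r, of i] by (intro f) simp
      then show "(\<lambda>i. f (r i) (\<Lambda> n)) \<longlonglongrightarrow> v n"
        by (intro tendsto_eventually eventually_sequentiallyI[of "Suc n"]) auto
    qed
  qed
qed

section \<open>Boundary values of bounded analytic functions\<close>

interpretation circle: finite_measure circle_measure
  by (rule finite_measureI) (simp add: space_circle_measure emeasure_circle_measure_space)

lemma borel_measurable_circle_measure:
  fixes f :: "complex \<Rightarrow> 'a::topological_space"
  assumes "continuous_on (sphere 0 1) f"
  shows "f \<in> borel_measurable circle_measure"
  using borel_measurable_continuous_on_restrict[OF assms]
  by (simp add: circle_measure_def cong: measurable_cong_sets)

lemma integrable_circle_measure:
  fixes f :: "complex \<Rightarrow> 'a::{banach, second_countable_topology}"
  assumes "continuous_on (sphere 0 1) f"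
  shows "integrable circle_measure f"
proof -
  have "compact (f ` sphere 0 1)"
    using assms by (intro compact_continuous_image) auto
  then obtain B where "\<And>x. x \<in> sphere 0 1 \<Longrightarrow> norm (f x) \<le> B"
    using compact_imp_bounded bounded_iff by (metis imageI)
  then show ?thesis
    using borel_measurable_circle_measure[OF assms]
    by (intro circle.integrable_const_bound[where B = B]) (auto simp: space_circle_measure intro!: AE_I2)
qed

text \<open>The gauge integral over the angle is the form to which contour integrals along
  \<open>circlepath\<close> reduce, so results on contour integrals can be carried over to
  \<open>circle_measure\<close>.\<close>

lemma integral_circle_measure:
  fixes f :: "complex \<Rightarrow> complex"
  assumes "continuous_on (sphere 0 1) f"
  shows "((\<lambda>t. f (cis t)) has_integral 2 * pi * (\<integral>\<xi>. f \<xi> \<partial>circle_measure)) {0..2*pi}"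
proof -
  have cont: "continuous_on A (\<lambda>t. f (cis t))" for A
    by (rule continuous_on_compose2[OF assms]) (auto intro!: continuous_intros)
  have meas: "f \<in> borel_measurable (restrict_space borel (sphere 0 1))"
    by (rule borel_measurable_continuous_on_restrict[OF assms])
  have [measurable]: "(\<lambda>t. f (cis t)) \<in> borel_measurable borel"
    by (rule borel_measurable_continuous_onI[OF cont])
  have "(\<integral>\<xi>. f \<xi> \<partial>circle_measure) = (\<integral>t. f (cis t) \<partial>uniform_measure lborel {0..<2*pi})"
    unfolding circle_measure_def by (rule integral_distr[OF measurable_cis_circle meas])
  also have "\<dots> = (\<integral>t. (indicator {0..<2*pi} t / (2*pi)) *\<^sub>R f (cis t) \<partial>lborel)"
  proof -
    have "uniform_measure lborel {0..<2*pi} = density lborel (\<lambda>t. ennreal (indicator {0..<2*pi} t / (2*pi)))"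
      unfolding uniform_measure_def
      by (intro density_cong) (auto simp: indicator_def divide_ennreal simp flip: ennreal_1 ennreal_0)
    then show ?thesis
      by (simp add: integral_density)
  qed
  \<comment> \<open>The half-open interval is closed up at the cost of the null set consisting of
    \<open>2 * pi\<close>.\<close>
  also have "\<dots> = (\<integral>t. (1 / (2*pi)) *\<^sub>R (indicator {0..2*pi} t *\<^sub>R f (cis t)) \<partial>lborel)"
  proof (rule integral_cong_AE)
    show "AE t in lborel. (indicator {0..<2*pi} t / (2*pi)) *\<^sub>R f (cis t) =
         (1 / (2*pi)) *\<^sub>R (indicator {0..2*pi} t *\<^sub>R f (cis t))"
      using AE_lborel_singleton[of "2*pi"] by eventually_elim (auto simp: indicator_def)
  qed measurable
  also have "\<dots> = (1 / (2*pi)) *\<^sub>R (LINT t:{0..2*pi}|lborel. f (cis t))"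
    by (simp only: set_lebesgue_integral_def integral_scaleR_right)
  finally have eq: "2 * pi * (\<integral>\<xi>. f \<xi> \<partial>circle_measure) = (LINT t:{0..2*pi}|lborel. f (cis t))"
    by (simp add: scaleR_conv_of_real)
  have "set_integrable lborel {0..2*pi} (\<lambda>t. f (cis t))"
    by (rule borel_integrable_compact[OF compact_Icc cont, folded set_integrable_def])
  from set_borel_integral_eq_integral[OF this] show ?thesis
    unfolding eq by (simp add: has_integral_integrable_integral)
qed

text \<open>With \<xi> = cis t one has d\<xi> = i \<xi> dt, so the extra factor \<xi> in the kernel
  turns Cauchy's formula into an integral against normalized arc length.\<close>

lemma Cauchy_integral_circle_measure:
  assumes f: "f holomorphic_on cball 0 1" and z: "cmod z < 1"
  shows "(\<integral>\<xi>. \<xi> / (\<xi> - z) * f \<xi> \<partial>circle_measure) = f z"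
proof -
  have cont: "continuous_on (sphere 0 1) f"
    using holomorphic_on_imp_continuous_on[OF f] by (rule continuous_on_subset) auto
  have "continuous_on (sphere 0 1) (\<lambda>\<xi>. \<xi> / (\<xi> - z) * f \<xi>)"
    using z by (intro continuous_intros cont) auto
  from has_integral_mult_left[OF integral_circle_measure[OF this], of \<i>]
  have "((\<lambda>t. f (cis t) / (cis t - z) * \<i> * cis t) has_integral
         2 * pi * (\<integral>\<xi>. \<xi> / (\<xi> - z) * f \<xi> \<partial>circle_measure) * \<i>) {0..2*pi}"
    by (simp add: mult_ac)
  moreover have "((\<lambda>t. f (cis t) / (cis t - z) * \<i> * cis t) has_integral 2 * pi * \<i> * f z) {0..2*pi}"
    using Cauchy_integral_circlepath_simple[OF f, of z] z
    by (simp add: circlepath_def has_contour_integral_part_circlepath_iff)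
  ultimately have "2 * pi * (\<integral>\<xi>. \<xi> / (\<xi> - z) * f \<xi> \<partial>circle_measure) * \<i> = 2 * pi * \<i> * f z"
    by (rule has_integral_unique)
  then show ?thesis
    by simp
qed

lemma mean_value_circle_measure:
  assumes "f holomorphic_on cball 0 1"
  shows "(\<integral>\<xi>. f \<xi> \<partial>circle_measure) = f 0"
proof -
  have "(\<integral>\<xi>. f \<xi> \<partial>circle_measure) = (\<integral>\<xi>. \<xi> / (\<xi> - 0) * f \<xi> \<partial>circle_measure)"
    by (intro Bochner_Integration.integral_cong) (auto simp: space_circle_measure)
  then show ?thesis
    using Cauchy_integral_circle_measure[OF assms, of 0] by simp
qed

lemma cnj_eq_inverse_on_circle: "cmod \<xi> = 1 \<Longrightarrow> cnj \<xi> = inverse \<xi>"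
  using complex_norm_square[of \<xi>] inverse_unique[of \<xi> "cnj \<xi>"] by simp

text \<open>Split Re f into (f + cnj f) / 2. The kernel equals 2 \<xi> / (\<xi> - z) - 1, so the
  part with f gives 2 f(z) - f(0) by Cauchy's formula and the mean value property. The part with cnj
  f gives cnj (f(0)).\<close>

lemma Schwarz_integral_circle_measure:
  assumes f: "f holomorphic_on cball 0 1" and z: "cmod z < 1"
  shows "(\<integral>\<xi>. (\<xi> + z) / (\<xi> - z) * of_real (Re (f \<xi>)) \<partial>circle_measure) = f z - \<i> * of_real (Im (f 0))"
proof -
  have cont: "continuous_on (sphere 0 1) f"
    using holomorphic_on_imp_continuous_on[OF f] by (rule continuous_on_subset) auto
  have half: "q * of_real (Re v) = (q * v + q * cnj v) / 2" for q v
    by (simp add: complex_add_cnj flip: distrib_left)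
  have int: "integrable circle_measure f" "integrable circle_measure (\<lambda>\<xi>. \<xi> / (\<xi> - z) * f \<xi>)"
    "integrable circle_measure (\<lambda>\<xi>. (\<xi> + z) / (\<xi> - z) * f \<xi>)"
    "integrable circle_measure (\<lambda>\<xi>. (\<xi> + z) / (\<xi> - z) * cnj (f \<xi>))"
    using z by (auto intro!: integrable_circle_measure continuous_intros cont)
  have "(\<integral>\<xi>. (\<xi> + z) / (\<xi> - z) * f \<xi> \<partial>circle_measure) =
        (\<integral>\<xi>. 2 * (\<xi> / (\<xi> - z) * f \<xi>) - f \<xi> \<partial>circle_measure)"
  proof (rule Bochner_Integration.integral_cong)
    fix \<xi> assume "\<xi> \<in> space circle_measure"
    then have "\<xi> - z \<noteq> 0"
      using z by (auto simp: space_circle_measure)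
    then show "(\<xi> + z) / (\<xi> - z) * f \<xi> = 2 * (\<xi> / (\<xi> - z) * f \<xi>) - f \<xi>"
      by (simp add: field_simps)
  qed auto
  also have "\<dots> = 2 * f z - f 0"
    by (simp only: Bochner_Integration.integral_diff[OF integrable_mult_right[OF int(2)] int(1)]
        integral_mult_right_zero Cauchy_integral_circle_measure[OF f z] mean_value_circle_measure[OF f])
  finally have 1: "(\<integral>\<xi>. (\<xi> + z) / (\<xi> - z) * f \<xi> \<partial>circle_measure) = 2 * f z - f 0" .
  \<comment> \<open>Since cnj \<xi> = 1 / \<xi> on the circle, the integrand is the conjugate of a
    function holomorphic on the closed disk whose value at 0 is \<open>f 0\<close>.\<close>
  have "(\<integral>\<xi>. (\<xi> + z) / (\<xi> - z) * cnj (f \<xi>) \<partial>circle_measure) =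
        (\<integral>\<xi>. cnj ((1 + cnj z * \<xi>) / (1 - cnj z * \<xi>) * f \<xi>) \<partial>circle_measure)"
  proof (rule Bochner_Integration.integral_cong)
    fix \<xi> assume "\<xi> \<in> space circle_measure"
    then have \<xi>: "cmod \<xi> = 1"
      by (auto simp: space_circle_measure)
    then have "\<xi> \<noteq> 0" "\<xi> - z \<noteq> 0"
      using z by auto
    then have "1 + z * inverse \<xi> = (\<xi> + z) / \<xi>" "1 - z * inverse \<xi> = (\<xi> - z) / \<xi>"
      by (simp_all add: field_simps)
    then show "(\<xi> + z) / (\<xi> - z) * cnj (f \<xi>) = cnj ((1 + cnj z * \<xi>) / (1 - cnj z * \<xi>) * f \<xi>)"
      using \<open>\<xi> \<noteq> 0\<close> by (simp add: cnj_eq_inverse_on_circle[OF \<xi>])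
  qed auto
  also have "\<dots> = cnj (f 0)"
  proof -
    have "(\<lambda>\<xi>. (1 + cnj z * \<xi>) / (1 - cnj z * \<xi>) * f \<xi>) holomorphic_on cball 0 1"
      using one_minus_cnj_mult_nonzero[OF z] by (intro holomorphic_intros f) auto
    from mean_value_circle_measure[OF this] show ?thesis
      by (subst Bochner_Integration.integral_cnj) simp
  qed
  finally have 2: "(\<integral>\<xi>. (\<xi> + z) / (\<xi> - z) * cnj (f \<xi>) \<partial>circle_measure) = cnj (f 0)" .
  have "(\<integral>\<xi>. (\<xi> + z) / (\<xi> - z) * of_real (Re (f \<xi>)) \<partial>circle_measure) =
     (\<integral>\<xi>. ((\<xi> + z) / (\<xi> - z) * f \<xi> + (\<xi> + z) / (\<xi> - z) * cnj (f \<xi>)) / 2 \<partial>circle_measure)"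
    by (simp only: half)
  also have "\<dots> = (2 * f z - f 0 + cnj (f 0)) / 2"
    by (simp only: integral_divide_zero Bochner_Integration.integral_add[OF int(3,4)] 1 2)
  also have "\<dots> = f z - \<i> * of_real (Im (f 0))"
    by (simp add: complex_eq_iff)
  finally show ?thesis .
qed

section \<open>Parseval's identity for power series on the circle\<close>

lemma integral_circle_measure_power:
  "(\<integral>\<xi>. \<xi> ^ n * cnj \<xi> ^ m \<partial>circle_measure) = (if n = m then 1 else 0)"
proof -
  \<comment> \<open>The right-hand side is the value of the monomial at 0; with
    \<open>0 ^ 0 = 1\<close> it covers the case \<open>n = m\<close>.\<close>
  have *: "(\<integral>\<xi>. \<xi> ^ n * cnj \<xi> ^ m \<partial>circle_measure) = 0 ^ (n - m)" if "m \<le> n" for n m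
  proof -
    have "(\<integral>\<xi>. \<xi> ^ n * cnj \<xi> ^ m \<partial>circle_measure) = (\<integral>\<xi>. \<xi> ^ (n - m) \<partial>circle_measure)"
    proof (rule Bochner_Integration.integral_cong)
      fix \<xi> assume "\<xi> \<in> space circle_measure"
      then have \<xi>: "cmod \<xi> = 1"
        by (auto simp: space_circle_measure)
      then have "\<xi> \<noteq> 0"
        by auto
      then show "\<xi> ^ n * cnj \<xi> ^ m = \<xi> ^ (n - m)"
        using that by (auto simp add: cnj_eq_inverse_on_circle[OF \<xi>] power_diff power_inverse divide_inverse)
    qed auto
    also have "\<dots> = 0 ^ (n - m)"
      by (rule mean_value_circle_measure) (intro holomorphic_intros)
    finally show ?thesis .
  qed
  show ?thesis
  proof (cases "m \<le> n")
    case True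
    then show ?thesis by (simp add: * power_0_left)
  next
    case False
    have "(\<integral>\<xi>. \<xi> ^ n * cnj \<xi> ^ m \<partial>circle_measure) = (\<integral>\<xi>. cnj (\<xi> ^ m * cnj \<xi> ^ n) \<partial>circle_measure)"
      by (simp add: mult.commute)
    also have "\<dots> = cnj (0 ^ (m - n))"
      using False by (subst Bochner_Integration.integral_cnj, subst *) auto
    finally show ?thesis
      using False by (simp add: power_0_left)
  qed
qed

lemma Parseval_finite:
  fixes c :: "nat \<Rightarrow> complex"
  shows "(\<integral>\<xi>. (cmod (\<Sum>n<N. c n * \<xi> ^ n))\<^sup>2 \<partial>circle_measure) = (\<Sum>n<N. (cmod (c n))\<^sup>2)"
proof -
  have "complex_of_real (\<integral>\<xi>. (cmod (\<Sum>n<N. c n * \<xi> ^ n))\<^sup>2 \<partial>circle_measure) =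
     (\<integral>\<xi>. complex_of_real ((cmod (\<Sum>n<N. c n * \<xi> ^ n))\<^sup>2) \<partial>circle_measure)"
    by (rule integral_complex_of_real[symmetric])
  also have "\<dots> = (\<integral>\<xi>. (\<Sum>n<N. \<Sum>m<N. c n * cnj (c m) * (\<xi> ^ n * cnj \<xi> ^ m)) \<partial>circle_measure)"
    by (intro Bochner_Integration.integral_cong)
       (simp_all only: complex_norm_square cnj_sum sum_product complex_cnj_mult complex_cnj_power mult_ac)
  also have "\<dots> = (\<Sum>n<N. \<Sum>m<N. c n * cnj (c m) * (if n = m then 1 else 0))"
  proof -
    have "integrable circle_measure (\<lambda>\<xi>. c n * cnj (c m) * (\<xi> ^ n * cnj \<xi> ^ m))" for n m
      by (intro integrable_circle_measure continuous_intros)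
    then show ?thesis
      by (simp only: Bochner_Integration.integral_sum Bochner_Integration.integrable_sum
          integral_mult_right_zero integral_circle_measure_power)
  qed
  also have "\<dots> = complex_of_real (\<Sum>n<N. (cmod (c n))\<^sup>2)"
    by (simp add: if_distrib[of "\<lambda>x. _ * x"] sum.delta' complex_norm_square del: of_real_power cong: if_cong)
  finally show ?thesis
    by (simp only: of_real_eq_iff)
qed

text \<open>Absolute summability gives a constant majorant of the partial sums, so the finite
  identity passes to the limit by dominated convergence. The general \<open>h\<close> covers dilates
  of \<open>g\<close> as well as differences of two dilates.\<close>

lemma Parseval:
  fixes c :: "nat \<Rightarrow> complex"
  assumes c: "summable (\<lambda>n. cmod (c n))"
    and h: "\<And>\<xi>. cmod \<xi> = 1 \<Longrightarrow> (\<lambda>n. c n * \<xi> ^ n) sums h \<xi>"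
    and meas: "h \<in> borel_measurable circle_measure"
  shows "(\<lambda>n. (cmod (c n))\<^sup>2) sums (\<integral>\<xi>. (cmod (h \<xi>))\<^sup>2 \<partial>circle_measure)"
proof -
  have "(\<lambda>N. \<integral>\<xi>. (cmod (\<Sum>n<N. c n * \<xi> ^ n))\<^sup>2 \<partial>circle_measure)
        \<longlonglongrightarrow> (\<integral>\<xi>. (cmod (h \<xi>))\<^sup>2 \<partial>circle_measure)"
  proof (rule integral_dominated_convergence[where w = "\<lambda>_. (\<Sum>n. cmod (c n))\<^sup>2"])
    show "AE \<xi> in circle_measure. (\<lambda>N. (cmod (\<Sum>n<N. c n * \<xi> ^ n))\<^sup>2) \<longlonglongrightarrow> (cmod (h \<xi>))\<^sup>2"
      using h by (auto simp: space_circle_measure sums_def intro!: AE_I2 tendsto_intros)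
    fix N
    show "AE \<xi> in circle_measure. norm ((cmod (\<Sum>n<N. c n * \<xi> ^ n))\<^sup>2) \<le> (\<Sum>n. cmod (c n))\<^sup>2"
    proof (rule AE_I2)
      fix \<xi> assume "\<xi> \<in> space circle_measure"
      then have "cmod \<xi> = 1"
        by (auto simp: space_circle_measure)
      then have "cmod (\<Sum>n<N. c n * \<xi> ^ n) \<le> (\<Sum>n<N. cmod (c n))"
        by (intro sum_norm_le) (simp add: norm_mult norm_power)
      also have "\<dots> \<le> (\<Sum>n. cmod (c n))"
        by (rule sum_le_suminf[OF c]) auto
      finally show "norm ((cmod (\<Sum>n<N. c n * \<xi> ^ n))\<^sup>2) \<le> (\<Sum>n. cmod (c n))\<^sup>2"
        by (simp add: power_mono)
    qed
    show "(\<lambda>\<xi>. (cmod (\<Sum>n<N. c n * \<xi> ^ n))\<^sup>2) \<in> borel_measurable circle_measure"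
      by (intro borel_measurable_circle_measure continuous_intros)
  qed (use meas in auto)
  then show ?thesis
    by (simp add: Parseval_finite sums_def)
qed


text \<open>The density is W = Re b, with b the almost everywhere limit of dilates of
  \<open>g\<close>. The Schwarz integral of Re b recovers \<open>g\<close> up to the imaginary
  constant i Im g(0), whose exponential becomes the unimodular factor.\<close>

lemma exp_bounded_holomorphic_is_outer:
  assumes g: "g holomorphic_on ball 0 1" and M: "\<And>z. z \<in> ball 0 1 \<Longrightarrow> cmod (g z) \<le> M"
  shows "bounded_outer_function (\<lambda>z. exp (g z))"
proof -
  define a where "a n = (deriv ^^ n) g 0 / fact n" for n
  have a: "(\<lambda>n. a n * w ^ n) sums g w" if "cmod w < 1" for w
    using holomorphic_power_series[OF g, of w] that by (simp add: a_def)
  have a_sum: "summable (\<lambda>n. cmod (a n) * r ^ n)" if r: "0 \<le> r" "r < 1" for r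
  proof -
    obtain s where "r < s" "s < 1"
      using dense[OF r(2)] by blast
    with r a[of "of_real s"] have "summable (\<lambda>n. norm (a n * of_real r ^ n))"
      by (intro powser_insidea[where x = "of_real s"]) (auto simp: sums_iff)
    with r show ?thesis
      by (simp add: norm_mult norm_power)
  qed
  have circ: "cmod (of_real r * \<xi>) < 1" if "cmod \<xi> = 1" "0 \<le> r" "r < 1" for r \<xi>
    using that by (simp add: norm_mult)
  have cont: "continuous_on (sphere 0 1) (\<lambda>\<xi>. g (of_real r * \<xi>))" if "0 \<le> r" "r < 1" for r
    using that
    by (intro continuous_on_compose2[OF holomorphic_on_imp_continuous_on[OF g]] continuous_intros)
       (auto intro: circ)

  define J where "J r = (\<integral>\<xi>. (cmod (g (of_real r * \<xi>)))\<^sup>2 \<partial>circle_measure)" for r :: real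
  have J: "(\<lambda>n. (cmod (a n))\<^sup>2 * (r ^ n)\<^sup>2) sums J r" if r: "0 \<le> r" "r < 1" for r
  proof -
    have "(\<lambda>n. (cmod (a n * of_real (r ^ n)))\<^sup>2) sums J r"
      unfolding J_def
    proof (rule Parseval)
      show "summable (\<lambda>n. cmod (a n * of_real (r ^ n)))"
        using a_sum[OF r] r by (simp add: norm_mult norm_power)
      show "(\<lambda>n. a n * of_real (r ^ n) * \<xi> ^ n) sums g (of_real r * \<xi>)" if "cmod \<xi> = 1" for \<xi>
        using a[OF circ[OF that r]] by (simp add: power_mult_distrib mult.assoc)
    qed (intro borel_measurable_circle_measure cont r)
    with r show ?thesis
      by (simp add: norm_mult norm_power power_mult_distrib)
  qed
  \<comment> \<open>Coefficientwise this is (r^n - s^n)^2 \<le> r^(2n) - s^(2n), whose two sides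
    differ by 2 s^n (r^n - s^n). Increments of \<open>J\<close> thus control squared L2 distances
    between dilates.\<close>
  have diff: "(\<integral>\<xi>. (cmod (g (of_real r * \<xi>) - g (of_real s * \<xi>)))\<^sup>2 \<partial>circle_measure) \<le> J r - J s"
    if r: "s \<le> r" "0 \<le> s" "r < 1" for r s
  proof -
    have "(\<lambda>n. (cmod (a n * of_real (r ^ n - s ^ n)))\<^sup>2) sums
      (\<integral>\<xi>. (cmod (g (of_real r * \<xi>) - g (of_real s * \<xi>)))\<^sup>2 \<partial>circle_measure)"
    proof (rule Parseval)
      have "summable (\<lambda>n. cmod (a n) * r ^ n - cmod (a n) * s ^ n)"
        using r by (intro summable_diff a_sum) auto
      moreover have abs: "\<bar>r ^ n - s ^ n\<bar> = r ^ n - s ^ n" for n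
        using r by (simp add: power_mono)
      ultimately show "summable (\<lambda>n. cmod (a n * of_real (r ^ n - s ^ n)))"
        by (simp only: norm_mult norm_of_real abs right_diff_distrib)
      show "(\<lambda>n. a n * of_real (r ^ n - s ^ n) * \<xi> ^ n) sums (g (of_real r * \<xi>) - g (of_real s * \<xi>))"
        if "cmod \<xi> = 1" for \<xi>
        using sums_diff[OF a[OF circ[OF that, of r]] a[OF circ[OF that, of s]]] r
        by (simp add: power_mult_distrib algebra_simps)
    qed (use r in \<open>intro borel_measurable_circle_measure continuous_intros cont, auto\<close>)
    moreover have "(\<lambda>n. (cmod (a n))\<^sup>2 * (r ^ n)\<^sup>2 - (cmod (a n))\<^sup>2 * (s ^ n)\<^sup>2) sums (J r - J s)"
      using r by (intro sums_diff J) auto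
    moreover have "(cmod (a n * of_real (r ^ n - s ^ n)))\<^sup>2 \<le>
        (cmod (a n))\<^sup>2 * (r ^ n)\<^sup>2 - (cmod (a n))\<^sup>2 * (s ^ n)\<^sup>2" for n
    proof -
      have "0 \<le> s ^ n" "s ^ n \<le> r ^ n"
        using r by (auto intro: power_mono)
      then have "0 \<le> s ^ n * (r ^ n - s ^ n)"
        by simp
      then have "(r ^ n - s ^ n)\<^sup>2 \<le> (r ^ n)\<^sup>2 - (s ^ n)\<^sup>2"
        by (simp add: power2_eq_square algebra_simps)
      then have "(cmod (a n))\<^sup>2 * (r ^ n - s ^ n)\<^sup>2 \<le> (cmod (a n))\<^sup>2 * ((r ^ n)\<^sup>2 - (s ^ n)\<^sup>2)"
        by (intro mult_left_mono) auto
      then show ?thesis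
        unfolding norm_mult norm_of_real power_mult_distrib power2_abs by (simp add: right_diff_distrib)
    qed
    ultimately show ?thesis
      by (rule sums_le[rotated 1])
  qed

  define R :: "nat \<Rightarrow> real" where "R k = 1 - inverse (real (Suc k))" for k
  have R: "0 \<le> R k" "R k < 1" for k
    by (simp_all add: R_def inverse_le_1_iff)
  have R_mono: "R i \<le> R j" if "i \<le> j" for i j
    using that by (simp add: R_def le_imp_inverse_le)
  have R_lim: "R \<longlonglongrightarrow> 1"
    using tendsto_diff[OF tendsto_const LIMSEQ_inverse_real_of_nat, of 1]
    unfolding R_def[abs_def] by simp
  have gM: "cmod (g (of_real (R k) * \<xi>)) \<le> M" if "cmod \<xi> = 1" for k \<xi>
    using M circ[OF that R] by simp
  have one: "measure circle_measure (sphere 0 1) = 1"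
    by (simp add: measure_def emeasure_circle_measure_space)
  \<comment> \<open>The sequence increases by \<open>diff\<close> and is bounded by the square of
    \<open>M\<close>, because the circle has measure 1.\<close>
  have "Cauchy (\<lambda>k. J (R k))"
  proof -
    have "J (R k) \<le> M\<^sup>2" for k
    proof -
      have "J (R k) \<le> (\<integral>\<xi>. M\<^sup>2 \<partial>circle_measure)"
        unfolding J_def
        by (intro integral_mono integrable_circle_measure continuous_intros cont R power_mono gM)
           (auto simp: space_circle_measure)
      then show ?thesis
        by (simp add: one space_circle_measure)
    qed
    moreover have "incseq (\<lambda>k. J (R k))"
    proof (rule incseq_SucI)
      fix k
      have "0 \<le> (\<integral>\<xi>. (cmod (g (of_real (R (Suc k)) * \<xi>) - g (of_real (R k) * \<xi>)))\<^sup>2 \<partial>circle_measure)"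
        by simp
      also have "\<dots> \<le> J (R (Suc k)) - J (R k)"
        by (intro diff R R_mono) simp
      finally show "J (R k) \<le> J (R (Suc k))"
        by simp
    qed
    ultimately have "convergent (\<lambda>k. J (R k))"
      using incseq_convergent by (metis convergentI)
    then show ?thesis
      by (rule convergent_Cauchy)
  qed
  \<comment> \<open>Stated in L1, as \<open>cauchy_L1_AE_cauchy_subseq\<close> requires.\<close>
  have L1_Cauchy: "\<exists>N. \<forall>i\<ge>N. \<forall>j\<ge>N.
      (\<integral>\<xi>. norm (g (of_real (R i) * \<xi>) - g (of_real (R j) * \<xi>)) \<partial>circle_measure) < e"
    if "e > 0" for e
  proof -
    obtain N where N: "\<bar>J (R i) - J (R j)\<bar> < e\<^sup>2" if "i \<ge> N" "j \<ge> N" for i j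
      using CauchyD[OF \<open>Cauchy (\<lambda>k. J (R k))\<close>, of "e\<^sup>2"] \<open>e > 0\<close> by (auto simp: dist_real_def)
    have "(\<integral>\<xi>. norm (g (of_real (R i) * \<xi>) - g (of_real (R j) * \<xi>)) \<partial>circle_measure) < e"
      if "i \<ge> N" "j \<ge> N" for i j
    proof -
      define D where "D \<xi> = cmod (g (of_real (R i) * \<xi>) - g (of_real (R j) * \<xi>))" for \<xi>
      have D: "continuous_on (sphere 0 1) D"
        unfolding D_def by (intro continuous_intros cont R)
      have D2: "(\<integral>\<xi>. (D \<xi>)\<^sup>2 \<partial>circle_measure) < e\<^sup>2"
      proof (cases "i \<le> j")
        case True
        have "(\<integral>\<xi>. (D \<xi>)\<^sup>2 \<partial>circle_measure) \<le> J (R j) - J (R i)"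
          using diff[OF R_mono[OF True] R] by (simp add: D_def norm_minus_commute)
        with N[OF that] show ?thesis
          by linarith
      next
        case False
        then have "(\<integral>\<xi>. (D \<xi>)\<^sup>2 \<partial>circle_measure) \<le> J (R i) - J (R j)"
          using diff[OF R_mono R, of j i] by (simp add: D_def)
        with N[OF that] show ?thesis
          by linarith
      qed
      \<comment> \<open>Passage from L2 to L1 by the arithmetic-geometric mean inequality, weighted
        so that an integral of D^2 below e^2 gives exactly the bound e.\<close>
      have "(\<integral>\<xi>. D \<xi> \<partial>circle_measure) \<le> (\<integral>\<xi>. (e + (D \<xi>)\<^sup>2 / e) / 2 \<partial>circle_measure)"
      proof (rule integral_mono)
        fix \<xi>
        have "0 \<le> (D \<xi> - e)\<^sup>2 / e"
          using \<open>e > 0\<close> by simp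
        also have "\<dots> = (e + (D \<xi>)\<^sup>2 / e) - 2 * D \<xi>"
          using \<open>e > 0\<close> by (simp add: power2_eq_square field_simps)
        finally show "D \<xi> \<le> (e + (D \<xi>)\<^sup>2 / e) / 2"
          by simp
      qed (use \<open>e > 0\<close> in \<open>auto intro!: integrable_circle_measure continuous_intros D\<close>)
      also have "\<dots> = (e + (\<integral>\<xi>. (D \<xi>)\<^sup>2 \<partial>circle_measure) / e) / 2"
      proof -
        have "integrable circle_measure (\<lambda>\<xi>. (D \<xi>)\<^sup>2)"
          by (intro integrable_circle_measure continuous_intros D)
        then show ?thesis
          by (simp add: one space_circle_measure)
      qed
      also have "\<dots> < e"
        using D2 \<open>e > 0\<close> by (simp add: field_simps power2_eq_square)
      finally show ?thesis
        by (simp add: D_def)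
    qed
    then show ?thesis
      by blast
  qed
  obtain q where q: "strict_mono q"
      and q_Cauchy: "AE \<xi> in circle_measure. Cauchy (\<lambda>i. g (of_real (R (q i)) * \<xi>))"
    using cauchy_L1_AE_cauchy_subseq[of circle_measure "\<lambda>k \<xi>. g (of_real (R k) * \<xi>)"] L1_Cauchy
      integrable_circle_measure[OF cont[OF R]] by blast
  \<comment> \<open>Where the sequence diverges \<open>lim\<close> is unspecified; by
    \<open>q_Cauchy\<close> this concerns a null set only.\<close>
  define b where "b \<xi> = lim (\<lambda>i. g (of_real (R (q i)) * \<xi>))" for \<xi>
  have [measurable]: "(\<lambda>\<xi>. g (of_real (R k) * \<xi>)) \<in> borel_measurable circle_measure" for k
    by (intro borel_measurable_circle_measure cont R)
  have [measurable]: "b \<in> borel_measurable circle_measure"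
    unfolding b_def by measurable
  have b: "AE \<xi> in circle_measure. (\<lambda>i. g (of_real (R (q i)) * \<xi>)) \<longlonglongrightarrow> b \<xi>"
    using q_Cauchy by eventually_elim (simp add: b_def Cauchy_convergent_iff convergent_LIMSEQ_iff)
  have bM: "AE \<xi> in circle_measure. cmod (b \<xi>) \<le> M"
    using b AE_space
  proof eventually_elim
    fix \<xi> assume "(\<lambda>i. g (of_real (R (q i)) * \<xi>)) \<longlonglongrightarrow> b \<xi>" "\<xi> \<in> space circle_measure"
    then show "cmod (b \<xi>) \<le> M"
      by (intro Lim_norm_ubound[of sequentially] always_eventually) (auto simp: space_circle_measure gM)
  qed
  have Rq: "(\<lambda>i. of_real (R (q i)) * z) \<longlonglongrightarrow> z" for z :: complex
    using tendsto_mult_right[OF tendsto_of_real[OF LIMSEQ_subseq_LIMSEQ[OF R_lim q]], where c = z]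
    by (simp add: o_def)

  \<comment> \<open>Both sides are limits of the Schwarz integrals of the dilates, which are
    holomorphic on the closed disk. The left one arises by dominated convergence with the kernel
    times \<open>M\<close> as majorant, the right one by continuity of \<open>g\<close> at
    \<open>z\<close>. All dilates share the value \<open>g 0\<close> at the origin.\<close>
  have rep: "(\<integral>\<xi>. (\<xi> + z) / (\<xi> - z) * of_real (Re (b \<xi>)) \<partial>circle_measure) = g z - \<i> * of_real (Im (g 0))"
    if z: "z \<in> ball 0 1" for z
  proof (rule LIMSEQ_unique)
    show "(\<lambda>i. \<integral>\<xi>. (\<xi> + z) / (\<xi> - z) * of_real (Re (g (of_real (R (q i)) * \<xi>))) \<partial>circle_measure)
      \<longlonglongrightarrow> (\<integral>\<xi>. (\<xi> + z) / (\<xi> - z) * of_real (Re (b \<xi>)) \<partial>circle_measure)"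
    proof (rule integral_dominated_convergence[where w = "\<lambda>\<xi>. cmod ((\<xi> + z) / (\<xi> - z)) * M"])
      have k: "continuous_on (sphere 0 1) (\<lambda>\<xi>. (\<xi> + z) / (\<xi> - z))"
        using z by (intro continuous_intros) auto
      note [measurable] = borel_measurable_circle_measure[OF k]
      show "(\<lambda>\<xi>. (\<xi> + z) / (\<xi> - z) * of_real (Re (b \<xi>))) \<in> borel_measurable circle_measure"
        "(\<lambda>\<xi>. (\<xi> + z) / (\<xi> - z) * of_real (Re (g (of_real (R (q i)) * \<xi>)))) \<in> borel_measurable circle_measure" for i
        by measurable
      show "integrable circle_measure (\<lambda>\<xi>. cmod ((\<xi> + z) / (\<xi> - z)) * M)"
        by (intro integrable_circle_measure continuous_on_mult continuous_on_norm k continuous_on_const)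
      show "AE \<xi> in circle_measure. (\<lambda>i. (\<xi> + z) / (\<xi> - z) * of_real (Re (g (of_real (R (q i)) * \<xi>))))
         \<longlonglongrightarrow> (\<xi> + z) / (\<xi> - z) * of_real (Re (b \<xi>))"
        using b by eventually_elim (intro tendsto_intros)
      show "AE \<xi> in circle_measure. norm ((\<xi> + z) / (\<xi> - z) * of_real (Re (g (of_real (R (q i)) * \<xi>))))
         \<le> cmod ((\<xi> + z) / (\<xi> - z)) * M" for i
      proof (rule AE_I2)
        fix \<xi> assume "\<xi> \<in> space circle_measure"
        then have "\<bar>Re (g (of_real (R (q i)) * \<xi>))\<bar> \<le> M"
          by (intro order_trans[OF abs_Re_le_cmod gM]) (simp add: space_circle_measure)
        then show "norm ((\<xi> + z) / (\<xi> - z) * of_real (Re (g (of_real (R (q i)) * \<xi>))))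
         \<le> cmod ((\<xi> + z) / (\<xi> - z)) * M"
          unfolding norm_mult norm_of_real by (intro mult_left_mono) auto
      qed
    qed
    have "(\<integral>\<xi>. (\<xi> + z) / (\<xi> - z) * of_real (Re (g (of_real (R (q i)) * \<xi>))) \<partial>circle_measure) =
        g (of_real (R (q i)) * z) - \<i> * of_real (Im (g 0))" for i
    proof -
      have "(\<lambda>w. g (of_real (R (q i)) * w)) holomorphic_on cball 0 1"
      proof (rule holomorphic_on_compose_gen[OF _ g, unfolded o_def])
        show "(\<lambda>w::complex. of_real (R (q i)) * w) ` cball 0 1 \<subseteq> ball 0 1"
        proof (rule image_subsetI)
          fix w :: complex assume "w \<in> cball 0 1"
          then have "R (q i) * cmod w \<le> R (q i)"
            using R[of "q i"] by (simp add: mult_left_le)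
          then show "of_real (R (q i)) * w \<in> ball 0 1"
            using R[of "q i"] by (simp add: norm_mult)
        qed
      qed (intro holomorphic_intros)
      from Schwarz_integral_circle_measure[OF this, of z] z show ?thesis
        by simp
    qed
    moreover have "isCont g z"
      using holomorphic_on_imp_continuous_on[OF g] z by (simp add: continuous_on_eq_continuous_at)
    ultimately show "(\<lambda>i. \<integral>\<xi>. (\<xi> + z) / (\<xi> - z) * of_real (Re (g (of_real (R (q i)) * \<xi>))) \<partial>circle_measure)
      \<longlonglongrightarrow> g z - \<i> * of_real (Im (g 0))"
      using isCont_tendsto_compose[OF _ Rq] by (auto intro!: tendsto_intros)
  qed

  have "outer_function (\<lambda>z. exp (g z))"
    unfolding outer_function_def
  proof (intro conjI exI ballI)
    show "(\<lambda>z. exp (g z)) analytic_on ball 0 1"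
      by (simp add: analytic_on_open holomorphic_on_exp' g)
    show "cmod (exp (\<i> * of_real (Im (g 0)))) = 1"
      by simp
    show "ereal_integrable circle_measure (\<lambda>\<xi>. ereal (Re (b \<xi>)))"
    proof -
      have "(\<integral>\<^sup>+ \<xi>. e2ennreal \<bar>ereal (Re (b \<xi>))\<bar> \<partial>circle_measure) \<le> (\<integral>\<^sup>+ \<xi>. ennreal M \<partial>circle_measure)"
        using bM
        by (intro nn_integral_mono_AE, eventually_elim)
           (auto simp: simp flip: ennreal.abs_eq intro!: ennreal_leI order_trans[OF abs_Re_le_cmod])
      also have "\<dots> < \<infinity>"
        by (simp add: space_circle_measure emeasure_circle_measure_space)
      finally show ?thesis
        unfolding ereal_integrable_def by auto
    qed
    fix z :: complex assume "z \<in> ball 0 1"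
    from rep[OF this] show "exp (g z) = exp (\<i> * of_real (Im (g 0))) *
        exp (\<integral>\<xi>. (\<xi> + z) / (\<xi> - z) * complex_of_real (real_of_ereal (ereal (Re (b \<xi>)))) \<partial>circle_measure)"
      by (simp flip: exp_add)
  qed
  moreover have "bounded ((\<lambda>z. exp (g z)) ` ball 0 1)"
  proof (rule boundedI, safe)
    fix z :: complex assume "z \<in> ball 0 1"
    then have "Re (g z) \<le> M"
      using M complex_Re_le_cmod order_trans by blast
    then show "cmod (exp (g z)) \<le> exp M"
      by simp
  qed
  ultimately show ?thesis
    by (simp add: bounded_outer_function_def)
qed

theorem theorem3p1:
  fixes \<Lambda> w :: "nat \<Rightarrow> complex"
  assumes "interpolating_sequence \<Lambda>"
    and "bounded (range w)"
    and "(INF n. cmod (w n)) > 0"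
  shows "\<exists>\<phi>. bounded_outer_function \<phi> \<and> (\<forall>n. \<phi> (\<Lambda> n) = w n)"
proof -
  define \<epsilon> where "\<epsilon> = (INF n. cmod (w n))"
  have \<epsilon>: "0 < \<epsilon>" "\<epsilon> \<le> cmod (w n)" for n
    using assms(3) by (auto simp: \<epsilon>_def intro!: cINF_lower bdd_belowI2[of _ 0])
  then have w0: "w n \<noteq> 0" for n
    by (metis norm_zero not_less)
  obtain C where C: "\<And>n. cmod (w n) \<le> C"
    using assms(2) by (auto simp: bounded_iff)
  \<comment> \<open>The lower bound \<epsilon> keeps the logarithms of the moduli from tending to
    minus infinity, and the principal branch keeps the imaginary parts within pi. The absolute
    values allow for either sign of \<open>ln \<epsilon>\<close> and \<open>ln C\<close>.\<close>
  have "cmod (Ln (w n)) \<le> \<bar>ln \<epsilon>\<bar> + \<bar>ln C\<bar> + pi" for n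
  proof -
    have "ln \<epsilon> \<le> ln (cmod (w n))" "ln (cmod (w n)) \<le> ln C"
      using \<epsilon> C[of n] w0[of n] by (auto intro!: ln_mono)
    then have "\<bar>Re (Ln (w n))\<bar> \<le> \<bar>ln \<epsilon>\<bar> + \<bar>ln C\<bar>"
      using w0[of n] by simp
    moreover have "\<bar>Im (Ln (w n))\<bar> \<le> pi"
      using mpi_less_Im_Ln[OF w0, of n] Im_Ln_le_pi[OF w0, of n] by linarith
    ultimately show ?thesis
      using cmod_le[of "Ln (w n)"] by linarith
  qed
  then have "bounded (range (\<lambda>n. Ln (w n)))"
    by (auto simp: bounded_iff)
  with assms(1) obtain g K where g: "g holomorphic_on ball 0 1" "\<And>z. z \<in> ball 0 1 \<Longrightarrow> cmod (g z) \<le> K"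
    and g_\<Lambda>: "\<And>n. g (\<Lambda> n) = Ln (w n)"
    by (rule Carleson_interpolation) blast
  show ?thesis
  proof (intro exI conjI allI)
    show "bounded_outer_function (\<lambda>z. exp (g z))"
      by (rule exp_bounded_holomorphic_is_outer[OF g])
    show "exp (g (\<Lambda> n)) = w n" for n
      using w0 by (simp add: g_\<Lambda>)
  qed
qed

end
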